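(* Let $n$ be a power of $2$ and let $A$ be an $n\times n$ symmetric matrix. Then the algorithm SymFHT (described in the context) applied to $A$ returns $HAH$, where $H=H_n$ is the $n\times n$ Hadamard matrix, after at most $n^2(2.5+\log n)$ arithmetic operations.
   Context: Hadamard matrix: $H_1=1$ and $H_n=\begin{bmatrix} H_{n/2} & H_{n/2} \\ H_{n/2} & -H_{n/2} \end{bmatrix}$ for $n$ a power of $2$. Logarithms are base $2$; arithmetic operations are additions/subtractions of scalars (transposing or copying is free). FHT (Fast Hadamard Transform): for an $n\times d$ matrix $M$, $\mathrm{FHT}(M)=H_nM$ is computed column by column by the standard recursion: for a column $a$ with upper half $a'$ and lower half $a''$, compute $H_{n/2}(a'+a'')$ and $H_{n/2}(a'-a'')$ recursively and stack them (for $n=1$, return $a$). It uses $nd\log n$ operations. SymFHT: for a $1\times1$ input, $\mathrm{SymFHT}(A)=A$. For $n\ge2$, write $A=\begin{bmatrix} A_{11} & A_{12} \\ A_{12}^\top & A_{22} \end{bmatrix}$ with $n/2\times n/2$ blocks. Compute $B_{11}=\mathrm{SymFHT}(A_{11})$, $B_{22}=\mathrm{SymFHT}(A_{22})$, $B_{12}=\mathrm{FHT}(\mathrm{FHT}(A_{12}^\top)^\top)$; then $$\begin{bmatrix} C_{11} & C_{12} \\ C_{21} & C_{22} \end{bmatrix}=\begin{bmatrix} B_{11}+B_{12}^\top & B_{11}-B_{12} \\ B_{12}+B_{22} & B_{12}^\top-B_{22} \end{bmatrix},$$ and return $\begin{bmatrix} C_{11}+C_{21} & C_{12}+C_{22}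 \\ C_{12}^\top+C_{22}^\top & C_{12}-C_{22} \end{bmatrix}$ (each of $C_{11},C_{12},C_{21},C_{22}$, $C_{11}+C_{21}$, $C_{12}+C_{22}$, $C_{12}-C_{22}$ is computed once; the lower-left block is the transpose of the upper-right block). *)

theory Defs
  imports Complex_Main "Jordan_Normal_Form.Matrix" "HOL-Library.Monad_Syntax"
begin

text \<open>
  A counted computation is its result together with the number of scalar additions and
  subtractions performed. Only the two scalar primitives \<open>add_c\<close> and \<open>sub_c\<close> have a cost;
  the cost of every other operation is accumulated from them by \<open>bind_c\<close>. Rearranging
  entries (splitting, stacking, transposing, copying) is done by ordinary functions and is free.
\<close>

type_synonym 'a counted = "'a \<times> nat"

abbreviation result :: "'a counted \<Rightarrow> 'a" where "result \<equiv> fst"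
abbreviation ops :: "'a counted \<Rightarrow> nat" where "ops \<equiv> snd"

definition return_c :: "'a \<Rightarrow> 'a counted" where
  "return_c x = (x, 0)"

definition bind_c :: "'a counted \<Rightarrow> ('a \<Rightarrow> 'b counted) \<Rightarrow> 'b counted" where
  "bind_c c f = (result (f (result c)), ops c + ops (f (result c)))"

adhoc_overloading Monad_Syntax.bind \<rightleftharpoons> bind_c

definition add_c :: "'a::comm_ring_1 \<Rightarrow> 'a \<Rightarrow> 'a counted" where
  "add_c x y = (x + y, 1)"

definition sub_c :: "'a::comm_ring_1 \<Rightarrow> 'a \<Rightarrow> 'a counted" where
  "sub_c x y = (x - y, 1)"

primrec mapM_c :: "('a \<Rightarrow> 'b counted) \<Rightarrow> 'a list \<Rightarrow> 'b list counted" where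
  "mapM_c f [] = return_c []"
| "mapM_c f (x # xs) = do { y \<leftarrow> f x; ys \<leftarrow> mapM_c f xs; return_c (y # ys) }"

definition vec_op :: "('a \<Rightarrow> 'a \<Rightarrow> 'a counted) \<Rightarrow> 'a vec \<Rightarrow> 'a vec \<Rightarrow> 'a vec counted" where
  "vec_op f u v = do {
     xs \<leftarrow> mapM_c (\<lambda>i. f (u $ i) (v $ i)) [0..<dim_vec u];
     return_c (vec_of_list xs) }"

definition mat_op :: "('a \<Rightarrow> 'a \<Rightarrow> 'a counted) \<Rightarrow> 'a mat \<Rightarrow> 'a mat \<Rightarrow> 'a mat counted" where
  "mat_op f A B = do {
     rs \<leftarrow> mapM_c (\<lambda>i. vec_op f (row A i) (row B i)) [0..<dim_row A];
     return_c (mat_of_rows (dim_col A) rs) }"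

text \<open>
  The functions below are meant for \<open>n\<close> a power of two, with \<open>n\<close> the dimension of the argument
  (its number of rows); their values for other \<open>n\<close> are irrelevant.
\<close>

fun hadamard :: "nat \<Rightarrow> 'a::comm_ring_1 mat" where
  "hadamard n =
     (if n \<le> 1 then 1\<^sub>m 1
      else let H = hadamard (n div 2) in four_block_mat H H H (- H))"

declare hadamard.simps [simp del]

fun fht_vec :: "nat \<Rightarrow> 'a::comm_ring_1 vec \<Rightarrow> 'a vec counted" where
  "fht_vec n a =
     (if n \<le> 1 then return_c a
      else do {
        let m = n div 2;
        let a' = vec_first a m;
        let a'' = vec_last a m;
        s \<leftarrow> vec_op add_c a' a'';
        d \<leftarrow> vec_op sub_c a' a'';
        x \<leftarrow> fht_vec m s;
        y \<leftarrow> fht_vec m d;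
        return_c (x @\<^sub>v y) })"

declare fht_vec.simps [simp del]

definition fht :: "'a::comm_ring_1 mat \<Rightarrow> 'a mat counted" where
  "fht M = do {
     cs \<leftarrow> mapM_c (fht_vec (dim_row M)) (cols M);
     return_c (mat_of_cols (dim_row M) cs) }"

text \<open>The lower-left block of the input is never read: it is the transpose of \<open>A12\<close>.\<close>

fun sym_fht :: "nat \<Rightarrow> 'a::comm_ring_1 mat \<Rightarrow> 'a mat counted" where
  "sym_fht n A =
     (if n \<le> 1 then return_c A
      else do {
        let m = n div 2;
        let (A11, A12, _, A22) = split_block A m m;
        B11 \<leftarrow> sym_fht m A11;
        B22 \<leftarrow> sym_fht m A22;
        X \<leftarrow> fht (transpose_mat A12);
        B12 \<leftarrow> fht (transpose_mat X);
        C11 \<leftarrow> mat_op add_c B11 (transpose_mat B12);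
        C12 \<leftarrow> mat_op sub_c B11 B12;
        C21 \<leftarrow> mat_op add_c B12 B22;
        C22 \<leftarrow> mat_op sub_c (transpose_mat B12) B22;
        D11 \<leftarrow> mat_op add_c C11 C21;
        D12 \<leftarrow> mat_op add_c C12 C22;
        D22 \<leftarrow> mat_op sub_c C12 C22;
        return_c (four_block_mat D11 D12 (transpose_mat D12) D22) })"

declare sym_fht.simps [simp del]

definition SymFHT :: "'a::comm_ring_1 mat \<Rightarrow> 'a mat counted" where
  "SymFHT A = sym_fht (dim_row A) A"

end

theory Submission
  imports Defs
begin

text \<open>
  Write \<open>n = 2m\<close>, \<open>H\<close> for the Hadamard matrix of size \<open>m\<close>, and \<open>P = H A11 H\<close>, \<open>Q = H A12 H\<close>,
  \<open>R = H A22 H\<close>. Multiplying out the block form of the Hadamard matrix of size \<open>n\<close>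
  (\<open>hadamard_block_conjugation\<close>) expresses each block of the conjugated matrix as a signed sum of
  \<open>P\<close>, \<open>Q\<close>, \<open>Q\<^sup>T\<close>, \<open>R\<close>; the symmetry of \<open>A\<close> and of \<open>H\<close> is what turns the contribution of the
  lower-left block into \<open>Q\<^sup>T\<close>. The algorithm obtains \<open>P\<close> and \<open>R\<close> recursively and \<open>Q\<close> by two fast
  transforms, and its seven block additions produce exactly these signed sums.

  Before the last combination step, right multiplication by the large matrix would leave the first
  block column \<open>P + Q\<close>, \<open>Q\<^sup>T + R\<close>. The algorithm computes \<open>P + Q\<^sup>T\<close>, \<open>Q + R\<close> instead. This is
  harmless: only the sum of the two is used, and the lower-left block of the answer, which would
  need their difference, is copied from the upper-right one by symmetry.

  For the cost, the two fast transforms of size \<open>m = 2^k\<close> take \<open>2 k m\<^sup>2\<close> operations and the seven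
  block additions take \<open>7 m\<^sup>2\<close>, so the cost satisfies \<open>T(2m) = 2 T(m) + (2 k + 7) m\<^sup>2\<close> with
  \<open>T(1) = 0\<close>. This recurrence has the solution \<open>T(n) = n\<^sup>2 (log n + 3/2) - 3 n / 2\<close>
  (\<open>sym_fht_correct\<close>), which is below the claimed bound.

  Costs may depend on intermediate values, so every step is evaluated to its pair of result and
  count at once; for power-of-two dimensions the count turns out to depend on the dimensions only.
\<close>

section \<open>Counted entrywise operations\<close>

lemma mapM_c_uniform_cost:
  assumes "\<And>x. x \<in> set xs \<Longrightarrow> f x = (g x, c)"
  shows "mapM_c f xs = (map g xs, length xs * c)"
  using assms by (induction xs) (simp_all add: return_c_def bind_c_def)

lemma vec_op_eq:
  assumes "\<And>x y. f x y = (g x y, 1)" and "dim_vec u = n"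
  shows "vec_op f u v = (vec n (\<lambda>i. g (u $ i) (v $ i)), n)"
proof -
  have "mapM_c (\<lambda>i. f (u $ i) (v $ i)) [0..<n] = (map (\<lambda>i. g (u $ i) (v $ i)) [0..<n], n)"
    using mapM_c_uniform_cost[of "[0..<n]" "\<lambda>i. f (u $ i) (v $ i)" "\<lambda>i. g (u $ i) (v $ i)" 1]
    by (simp add: assms(1))
  then show ?thesis
    by (auto simp: vec_op_def bind_c_def return_c_def assms(2) vec_of_list_index
        simp del: vec_of_list_map)
qed

lemma mat_op_eq:
  assumes "\<And>x y. f x y = (g x y, 1)" and "A \<in> carrier_mat nr nc" and "B \<in> carrier_mat nr nc"
  shows "mat_op f A B = (mat nr nc (\<lambda>ij. g (A $$ ij) (B $$ ij)), nr * nc)"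
proof -
  have "mapM_c (\<lambda>i. vec_op f (row A i) (row B i)) [0..<nr]
      = (map (\<lambda>i. vec nc (\<lambda>j. g (row A i $ j) (row B i $ j))) [0..<nr], nr * nc)"
    using assms mapM_c_uniform_cost[of "[0..<nr]" "\<lambda>i. vec_op f (row A i) (row B i)"
        "\<lambda>i. vec nc (\<lambda>j. g (row A i $ j) (row B i $ j))" nc]
    by (simp add: vec_op_eq[OF assms(1), of _ nc])
  then show ?thesis
    using assms(2,3) by (auto simp: mat_op_def bind_c_def return_c_def mat_of_rows_index)
qed

lemma vec_op_add_c:
  "u \<in> carrier_vec n \<Longrightarrow> v \<in> carrier_vec n \<Longrightarrow> vec_op add_c u v = (u + v, n)"
  by (subst vec_op_eq[of add_c "(+)" u n]) (auto simp: add_c_def)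

lemma vec_op_sub_c:
  "u \<in> carrier_vec n \<Longrightarrow> v \<in> carrier_vec n \<Longrightarrow> vec_op sub_c u v = (u - v, n)"
  by (subst vec_op_eq[of sub_c "(-)" u n]) (auto simp: sub_c_def)

lemma mat_op_add_c:
  "A \<in> carrier_mat nr nc \<Longrightarrow> B \<in> carrier_mat nr nc \<Longrightarrow> mat_op add_c A B = (A + B, nr * nc)"
  by (subst mat_op_eq[of add_c "(+)" A nr nc]) (auto simp: add_c_def)

lemma mat_op_sub_c:
  "A \<in> carrier_mat nr nc \<Longrightarrow> B \<in> carrier_mat nr nc \<Longrightarrow> mat_op sub_c A B = (A - B, nr * nc)"
  by (subst mat_op_eq[of sub_c "(-)" A nr nc]) (auto simp: sub_c_def)

section \<open>Hadamard matrices\<close>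

lemma hadamard_1: "hadamard (Suc 0) = 1\<^sub>m 1"
  by (simp add: hadamard.simps)

lemma two_power_Suc_not_le_1: "\<not> 2 * 2 ^ k \<le> Suc 0"
  using one_le_power[of "2::nat" k] by linarith

lemma hadamard_Suc:
  "hadamard (2 ^ Suc k) = four_block_mat (hadamard (2 ^ k)) (hadamard (2 ^ k))
     (hadamard (2 ^ k)) (- hadamard (2 ^ k))"
  by (subst hadamard.simps) (simp add: Let_def two_power_Suc_not_le_1)

lemma hadamard_carrier: "hadamard (2 ^ k) \<in> carrier_mat (2 ^ k) (2 ^ k)"
proof (induction k)
  case 0
  show ?case by (simp add: hadamard_1)
next
  case (Suc k)
  then show ?case unfolding hadamard_Suc by (simp add: mult_2)
qed

lemma hadamard_symmetric: "transpose_mat (hadamard (2 ^ k)) = hadamard (2 ^ k)"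
proof (induction k)
  case 0
  show ?case by (simp add: hadamard_1)
next
  case (Suc k)
  note H = hadamard_carrier[of k]
  show ?case
    unfolding hadamard_Suc
    by (subst transpose_four_block_mat[OF H H H uminus_carrier_mat[OF H]])
      (simp add: Suc.IH transpose_uminus)
qed

text \<open>
  This holds for arbitrary blocks. Keeping the four conjugates opaque reduces the correctness of one
  recursion step to comparing entries of their signed sums.
\<close>

lemma hadamard_block_conjugation:
  fixes H :: "'a::comm_ring_1 mat"
  assumes H: "H \<in> carrier_mat m m"
    and A: "A \<in> carrier_mat m m" and B: "B \<in> carrier_mat m m"
    and C: "C \<in> carrier_mat m m" and D: "D \<in> carrier_mat m m"
    and P: "P = H * A * H" and Q: "Q = H * B * H" and S: "S = H * C * H" and R: "R = H * D * H"
  shows "four_block_mat H H H (- H) * four_block_mat A B C D * four_block_mat H H H (- H)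
    = four_block_mat (P + S + (Q + R)) (P + S - (Q + R)) (P - S + (Q - R)) (P - S - (Q - R))"
proof -
  note mH = uminus_carrier_mat[OF H]
  have left: "four_block_mat H H H (- H) * four_block_mat A B C D
      = four_block_mat (H * A + H * C) (H * B + H * D) (H * A - H * C) (H * B - H * D)"
    unfolding mult_four_block_mat[OF H H H mH A B C D]
    using H A B C D
    by (simp add: add_uminus_minus_mat[of _ m m])
  have p: "H * A \<in> carrier_mat m m" "H * B \<in> carrier_mat m m"
    "H * C \<in> carrier_mat m m" "H * D \<in> carrier_mat m m"
    using H A B C D by auto
  have c: "H * A + H * C \<in> carrier_mat m m" "H * B + H * D \<in> carrier_mat m m"
    "H * A - H * C \<in> carrier_mat m m" "H * B - H * D \<in> carrier_mat m m"
    by (intro add_carrier_mat minus_carrier_mat p)+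
  have "P + S = (H * A + H * C) * H" "Q + R = (H * B + H * D) * H"
    "P - S = (H * A - H * C) * H" "Q - R = (H * B - H * D) * H"
    unfolding P Q R S
    using add_mult_distrib_mat[OF p(1,3) H] add_mult_distrib_mat[OF p(2,4) H]
      minus_mult_distrib_mat[OF p(1,3) H] minus_mult_distrib_mat[OF p(2,4) H] by simp_all
  then show ?thesis
    unfolding left mult_four_block_mat[OF c H H H mH]
    using H A B C D mult_carrier_mat[OF c(1) H] mult_carrier_mat[OF c(2) H]
      mult_carrier_mat[OF c(3) H] mult_carrier_mat[OF c(4) H]
    by (simp add: add_uminus_minus_mat[of _ m m])
qed

section \<open>The fast Hadamard transform\<close>

text \<open>
  Both halves of the block product come from \<open>H u + H v = H (u + v)\<close> and \<open>H u - H v = H (u - v)\<close>, so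
  each level adds and subtracts before recursing, at a cost of \<open>2^k\<close> for each of the \<open>k\<close> levels.
\<close>

lemma fht_vec_correct:
  fixes a :: "'a::comm_ring_1 vec"
  assumes "a \<in> carrier_vec (2 ^ k)"
  shows "fht_vec (2 ^ k) a = (hadamard (2 ^ k) *\<^sub>v a, k * 2 ^ k)"
  using assms
proof (induction k arbitrary: a)
  case 0
  then show ?case by (simp add: fht_vec.simps hadamard_1 return_c_def)
next
  case (Suc k)
  let ?m = "2 ^ k :: nat"
  let ?H = "hadamard ?m :: 'a mat"
  define u v where "u = vec_first a ?m" and "v = vec_last a ?m"
  have u: "u \<in> carrier_vec ?m" and v: "v \<in> carrier_vec ?m"
    by (simp_all add: u_def v_def)
  have a: "a = u @\<^sub>v v"
    using Suc.prems unfolding u_def v_def by (simp add: mult_2)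
  note H = hadamard_carrier[of k, where 'a = 'a]
  have "hadamard (2 ^ Suc k) *\<^sub>v a = ?H *\<^sub>v (u + v) @\<^sub>v ?H *\<^sub>v (u - v)"
    unfolding a hadamard_Suc four_block_mat_mult_vec[OF H H H uminus_carrier_mat[OF H] u v]
    using u v H
    by (simp add: mult_add_distrib_mat_vec[OF H u v] mult_minus_distrib_mat_vec[OF H u v]
        minus_add_uminus_vec[of "?H *\<^sub>v u" ?m "?H *\<^sub>v v"])
  moreover have "fht_vec (2 ^ Suc k) a = (?H *\<^sub>v (u + v) @\<^sub>v ?H *\<^sub>v (u - v), Suc k * 2 ^ Suc k)"
    using u v
    by (subst fht_vec.simps)
      (simp add: two_power_Suc_not_le_1 Let_def u_def[symmetric] v_def[symmetric] bind_c_def return_c_def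
        vec_op_add_c[OF u v] vec_op_sub_c[OF u v] Suc.IH algebra_simps)
  ultimately show ?case by simp
qed

lemma fht_correct:
  fixes M :: "'a::comm_ring_1 mat"
  assumes M: "M \<in> carrier_mat (2 ^ k) d"
  shows "fht M = (hadamard (2 ^ k) * M, d * (k * 2 ^ k))"
proof -
  let ?H = "hadamard (2 ^ k) :: 'a mat"
  have "mapM_c (fht_vec (2 ^ k)) (cols M) = (map (\<lambda>c. ?H *\<^sub>v c) (cols M), d * (k * 2 ^ k))"
  proof -
    have "fht_vec (2 ^ k) c = (?H *\<^sub>v c, k * 2 ^ k)" if "c \<in> set (cols M)" for c
      using that M cols_dim[of M] by (intro fht_vec_correct) auto
    from mapM_c_uniform_cost[of "cols M", OF this] show ?thesis
      using M by simp
  qed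
  moreover have "mat_of_cols (2 ^ k) (map (\<lambda>c. ?H *\<^sub>v c) (cols M)) = ?H * M"
    using M hadamard_carrier[of k, where 'a = 'a]
    by (intro eq_matI) (auto simp: mat_of_cols_index)
  ultimately show ?thesis
    using M by (simp add: fht_def bind_c_def return_c_def)
qed

section \<open>The symmetric transform\<close>

text \<open>
  The multiplicative form of the cost avoids fractions and subtraction on natural numbers.
  Symmetry enters twice: it identifies the unread lower-left block of the input with the transpose
  of the upper-right one, and it makes the diagonal blocks symmetric. The latter is required by the
  induction, and it makes \<open>P\<close> and \<open>R\<close> symmetric, so that the lower-left block of the product is
  the transpose of the upper-right one.
\<close>

lemma sym_fht_correct:
  fixes A :: "'a::comm_ring_1 mat"
  assumes "A \<in> carrier_mat (2 ^ k) (2 ^ k)" and "transpose_mat A = A"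
  shows "\<exists>T. sym_fht (2 ^ k) A = (hadamard (2 ^ k) * A * hadamard (2 ^ k), T)
    \<and> 2 * T + 3 * 2 ^ k = (2 ^ k)\<^sup>2 * (2 * k + 3)"
  using assms
proof (induction k arbitrary: A)
  case 0
  then show ?case by (simp add: sym_fht.simps hadamard_1 return_c_def)
next
  case (Suc k)
  let ?m = "2 ^ k :: nat"
  define H where "H = (hadamard ?m :: 'a mat)"
  have H: "H \<in> carrier_mat ?m ?m" and Ht: "transpose_mat H = H"
    by (simp_all add: H_def hadamard_carrier hadamard_symmetric)
  obtain A11 A12 A21 A22 where sp: "split_block A ?m ?m = (A11, A12, A21, A22)"
    by (metis prod_cases4)
  have "dim_row A = ?m + ?m" "dim_col A = ?m + ?m"
    using Suc.prems(1) by auto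
  note blocks = split_block[OF sp this]
  note A11 = blocks(1) and A12 = blocks(2) and A21 = blocks(3) and A22 = blocks(4)
    and A = blocks(5)
  have Aij: "A $$ (j, i) = A $$ (i, j)" if "i < 2 * ?m" "j < 2 * ?m" for i j
    using that Suc.prems index_transpose_mat(1)[of i A j] by simp
  have sym: "transpose_mat A11 = A11" "transpose_mat A12 = A21" "transpose_mat A22 = A22"
    using sp Suc.prems(1) by (auto simp: split_block_def Let_def Aij intro!: eq_matI)
  define P Q R where "P = H * A11 * H" and "Q = H * A12 * H" and "R = H * A22 * H"
  have P: "P \<in> carrier_mat ?m ?m" and Q: "Q \<in> carrier_mat ?m ?m" and R: "R \<in> carrier_mat ?m ?m"
    using H A11 A12 A22 by (auto simp: P_def Q_def R_def)
  have Qt: "transpose_mat Q = H * A21 * H"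
    using H A12 A21 unfolding Q_def sym(2)[symmetric]
    by (simp add: transpose_mult[of _ ?m ?m _ ?m] Ht assoc_mult_mat[of _ ?m ?m _ ?m _ ?m])
  obtain T1 where T1: "sym_fht ?m A11 = (P, T1)" "2 * T1 + 3 * 2 ^ k = (2 ^ k)\<^sup>2 * (2 * k + 3)"
    using Suc.IH[OF A11 sym(1)] unfolding P_def H_def by blast
  obtain T2 where T2: "sym_fht ?m A22 = (R, T2)" "2 * T2 + 3 * 2 ^ k = (2 ^ k)\<^sup>2 * (2 * k + 3)"
    using Suc.IH[OF A22 sym(3)] unfolding R_def H_def by blast
  have X: "fht (transpose_mat A12) = (H * transpose_mat A12, ?m * (k * ?m))"
    unfolding H_def by (rule fht_correct) (use A12 in auto)
  have "transpose_mat (H * transpose_mat A12) = A12 * H"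
    using H A12 by (simp add: transpose_mult[of _ ?m ?m _ ?m] Ht)
  moreover have "fht (A12 * H) = (H * (A12 * H), ?m * (k * ?m))"
    unfolding H_def by (rule fht_correct) (use A12 H in \<open>auto simp: H_def\<close>)
  ultimately have B12: "fht (transpose_mat (H * transpose_mat A12)) = (Q, ?m * (k * ?m))"
    using H A12 by (simp add: Q_def assoc_mult_mat[of _ ?m ?m _ ?m _ ?m])
  let ?T = "T1 + T2 + 2 * (?m * (k * ?m)) + 7 * (?m * ?m)"
  let ?D12 = "P - Q + (transpose_mat Q - R)"
  have Qt': "transpose_mat Q \<in> carrier_mat ?m ?m"
    using Q by simp
  have run: "sym_fht (2 ^ Suc k) A
    = (four_block_mat (P + transpose_mat Q + (Q + R)) ?D12 (transpose_mat ?D12)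
        (P - Q - (transpose_mat Q - R)), ?T)"
    using P Q R Qt'
    by (subst sym_fht.simps)
      (simp add: two_power_Suc_not_le_1 Let_def sp T1(1) T2(1) X B12 bind_c_def return_c_def
        minus_carrier_mat mat_op_add_c[of _ ?m ?m] mat_op_sub_c[of _ ?m ?m])
  have Pt: "transpose_mat P = P" and Rt: "transpose_mat R = R"
    using H A11 A22 unfolding P_def R_def
    by (simp_all add: transpose_mult[of _ ?m ?m _ ?m] Ht sym assoc_mult_mat[of _ ?m ?m _ ?m _ ?m])
  have Pij: "P $$ (j, i) = P $$ (i, j)" and Rij: "R $$ (j, i) = R $$ (i, j)"
    if "i < ?m" "j < ?m" for i j
    using that P R index_transpose_mat(1)[of i P j] index_transpose_mat(1)[of i R j]
    by (simp_all add: Pt Rt)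
  have product: "hadamard (2 ^ Suc k) * A * hadamard (2 ^ Suc k)
    = four_block_mat (P + transpose_mat Q + (Q + R)) ?D12 (transpose_mat ?D12)
        (P - Q - (transpose_mat Q - R))"
  proof -
    have "P + transpose_mat Q - (Q + R) = ?D12"
      and "P - transpose_mat Q + (Q - R) = transpose_mat ?D12"
      and "P - transpose_mat Q - (Q - R) = P - Q - (transpose_mat Q - R)"
      using P Q R by (auto intro!: eq_matI simp: Pij Rij)
    then show ?thesis
      unfolding A hadamard_Suc H_def[symmetric]
        hadamard_block_conjugation[OF H A11 A12 A21 A22 P_def Q_def Qt R_def]
      by simp
  qed
  have "2 * ?T + 3 * 2 ^ Suc k = (2 ^ Suc k)\<^sup>2 * (2 * Suc k + 3)"
    using T1(2) T2(2) by (simp add: power2_eq_square algebra_simps)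
  then show ?case unfolding run product by blast
qed

theorem theorem5p2:
  fixes n :: nat and A :: "'a::comm_ring_1 mat"
  assumes "\<exists>k. n = 2 ^ k"
    and "A \<in> carrier_mat n n"
    and "transpose_mat A = A"
  shows "result (SymFHT A) = hadamard n * A * hadamard n
    \<and> real (ops (SymFHT A)) \<le> (real n)\<^sup>2 * (2.5 + log 2 (real n))"
proof -
  obtain k where n: "n = 2 ^ k" using assms(1) by blast
  obtain T where T: "sym_fht n A = (hadamard n * A * hadamard n, T)"
    "2 * T + 3 * n = n\<^sup>2 * (2 * k + 3)"
    using sym_fht_correct[of A k] assms(2,3) unfolding n by blast
  have "SymFHT A = (hadamard n * A * hadamard n, T)"
    using assms(2) T(1) by (simp add: SymFHT_def)
  moreover have "real T \<le> (real n)\<^sup>2 * (2.5 + log 2 (real n))"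
  proof -
    have log: "log 2 (real n) = real k" by (simp add: n)
    have "2 * real T + 3 * real n = (real n)\<^sup>2 * (2 * real k + 3)"
      using arg_cong[OF T(2), of real] by simp
    moreover have "(real n)\<^sup>2 * (2 * real k + 3) \<le> (real n)\<^sup>2 * (2 * real k + 5)"
      by (intro mult_left_mono) auto
    ultimately have "2 * real T \<le> (real n)\<^sup>2 * (2 * log 2 (real n) + 5)"
      unfolding log by linarith
    then show ?thesis by (simp add: algebra_simps)
  qed
  ultimately show ?thesis by simp
qed

end
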